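(* Let $T$ be a non-degenerate simplex in $\mathbb{R}^d$ with vertices ${\bf v}_0,\ldots,{\bf v}_d$, circumcenter ${\bf c}$ and circumradius $R$, let $$\mathcal E({\bf x})=\frac{R^2}{4}+|{\bf x}-\varphi({\bf x})|^2-\frac12|{\bf x}-{\bf c}|^2,\qquad {\bf x}\in\mathbb{R}^d,$$ and let $I\subset\{0,1,\ldots,d\}$ be a non-empty set. Then $$\mathcal E({\bf x})=\frac{R_I^2}{4}-\frac12\bigl({\rm dist}({\bf x},H_I)\bigr)^2+\frac12\bigl({\rm dist}({\bf x},Q_I)\bigr)^2,\qquad {\bf x}\in\overline{\varphi^{-1}(G_I)}.$$ Furthermore, the restriction of the gradient $\nabla\mathcal E$ to the set $\overline{\varphi^{-1}(G_I)}$ is an isometry; i.e., $$|\nabla\mathcal E({\bf x})-\nabla\mathcal E({\bf y})|=|{\bf x}-{\bf y}|,\qquad {\bf x},{\bf y}\in\overline{\varphi^{-1}(G_I)}.$$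
   Context: $|\cdot|$ is the Euclidean norm, ${\rm dist}$ the Euclidean distance from a point to a set, $\overline A$ the closure of $A$. A simplex with $d+1$ vertices in $\mathbb{R}^d$ is non-degenerate if it is not contained in any $(d-1)$-dimensional hyperplane. The circumcenter ${\bf c}$ is the point equidistant from all vertices, $R=|{\bf c}-{\bf v}_i|$. Let ${\bf u}_i=\frac12({\bf c}+{\bf v}_i)$, $i=0,\ldots,d$, and $U=\frac12({\bf c}+T)$, the simplex with vertices ${\bf u}_0,\ldots,{\bf u}_d$. The mapping $\varphi:\mathbb{R}^d\to U$ sends ${\bf x}$ to the unique point of $U$ closest to ${\bf x}$. For non-empty $I\subset\{0,\ldots,d\}$: $G_I:=\{{\bf x}\in U: b_i({\bf x})>0\text{ for }i\in I,\ b_i({\bf x})=0\text{ for }i\notin I\}$, where $b_i({\bf x})$ are the barycentric coordinates of ${\bf x}$ relative to $U$; $\varphi^{-1}(G_I)=\{{\bf x}\in\mathbb{R}^d:\varphi({\bf x})\in G_I\}$; $Q_I:=\{\sum_{i\in I}c_i{\bf v}_i:\sum_{i\in I}c_i=1\}$ is the affine span of $\{{\bf v}_i\}_{i\in I}$; $H_I$ is the set of all points of $\mathbb{R}^d$ equidistant from the points ${\bf v}_i$, $i\in I$; $R_I$ is the circumradius of the simplex $T_I$ with vertices ${\bf v}_i$, $i\in I$, i.e. the common distance to these vertices from the unique point ${\bf c}_I\in Q_I$ equidistant from them ($R_I=0$ if $I$ is a singleton). The function $\mathcal E$ is continuously differentiable on $\mathbb{R}^d$. *)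

theory Defs
  imports "HOL-Analysis.Analysis"
begin

text \<open>
  Euclidean space of dimension d is a type \<open>'a :: euclidean_space\<close> with d = \<open>DIM('a)\<close>.
  A simplex with d + 1 vertices is given by its vertex family \<open>v :: nat \<Rightarrow> 'a\<close>, of which
  only the values at the indices \<open>0, \<dots>, DIM('a)\<close> matter.
\<close>

definition simplex_of :: "(nat \<Rightarrow> 'a::euclidean_space) \<Rightarrow> 'a set" where
  "simplex_of v = convex hull (v ` {0..DIM('a)})"

definition nondegenerate :: "(nat \<Rightarrow> 'a::euclidean_space) \<Rightarrow> bool" where
  "nondegenerate v \<longleftrightarrow>
     \<not> (\<exists>P. affine P \<and> aff_dim P = int DIM('a) - 1 \<and> simplex_of v \<subseteq> P)"

definition Q_face :: "(nat \<Rightarrow> 'a::euclidean_space) \<Rightarrow> nat set \<Rightarrow> 'a set" where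
  "Q_face v I = affine hull (v ` I)"

definition H_face :: "(nat \<Rightarrow> 'a::euclidean_space) \<Rightarrow> nat set \<Rightarrow> 'a set" where
  "H_face v I = {x. \<forall>i\<in>I. \<forall>j\<in>I. dist x (v i) = dist x (v j)}"

definition circumcenter :: "(nat \<Rightarrow> 'a::euclidean_space) \<Rightarrow> 'a" where
  "circumcenter v = (THE c. c \<in> H_face v {0..DIM('a)})"

definition circumradius :: "(nat \<Rightarrow> 'a::euclidean_space) \<Rightarrow> real" where
  "circumradius v = (THE r. \<forall>i\<in>{0..DIM('a)}. dist (circumcenter v) (v i) = r)"

definition face_circumcenter :: "(nat \<Rightarrow> 'a::euclidean_space) \<Rightarrow> nat set \<Rightarrow> 'a" where
  "face_circumcenter v I = (THE c. c \<in> Q_face v I \<and> c \<in> H_face v I)"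

definition face_circumradius :: "(nat \<Rightarrow> 'a::euclidean_space) \<Rightarrow> nat set \<Rightarrow> real" where
  "face_circumradius v I = (THE r. \<forall>i\<in>I. dist (face_circumcenter v I) (v i) = r)"

definition u_vertex :: "(nat \<Rightarrow> 'a::euclidean_space) \<Rightarrow> nat \<Rightarrow> 'a" where
  "u_vertex v i = (1/2) *\<^sub>R (circumcenter v + v i)"

definition U_simplex :: "(nat \<Rightarrow> 'a::euclidean_space) \<Rightarrow> 'a set" where
  "U_simplex v = simplex_of (u_vertex v)"

definition proj_U :: "(nat \<Rightarrow> 'a::euclidean_space) \<Rightarrow> 'a \<Rightarrow> 'a" where
  "proj_U v x = closest_point (U_simplex v) x"

text \<open>
  Barycentric coordinates of \<open>x\<close> relative to the simplex with vertices \<open>w 0, \<dots>, w DIM('a)\<close>.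
  Setting the values outside the index range to 0 makes the coordinate function unique.
\<close>

definition barycentric :: "(nat \<Rightarrow> 'a::euclidean_space) \<Rightarrow> 'a \<Rightarrow> nat \<Rightarrow> real" where
  "barycentric w x = (THE b. (\<forall>i. i \<notin> {0..DIM('a)} \<longrightarrow> b i = 0)
      \<and> (\<Sum>i\<in>{0..DIM('a)}. b i) = 1 \<and> (\<Sum>i\<in>{0..DIM('a)}. b i *\<^sub>R w i) = x)"

definition G_face :: "(nat \<Rightarrow> 'a::euclidean_space) \<Rightarrow> nat set \<Rightarrow> 'a set" where
  "G_face v I = {x \<in> U_simplex v.
      (\<forall>i\<in>I. barycentric (u_vertex v) x i > 0) \<and>
      (\<forall>i\<in>{0..DIM('a)} - I. barycentric (u_vertex v) x i = 0)}"

definition energy :: "(nat \<Rightarrow> 'a::euclidean_space) \<Rightarrow> 'a \<Rightarrow> real" where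
  "energy v x = (circumradius v)\<^sup>2 / 4 + (norm (x - proj_U v x))\<^sup>2
      - (1/2) * (norm (x - circumcenter v))\<^sup>2"

text \<open>Meaningful at points where \<open>f\<close> is differentiable, where the gradient is unique.\<close>

definition gradient :: "('a::euclidean_space \<Rightarrow> real) \<Rightarrow> 'a \<Rightarrow> 'a" where
  "gradient f x = (THE g. GDERIV f x :> g)"

end

theory Submission
  imports Defs
begin

text \<open>
  If \<open>\<phi> x\<close> lies in the relative interior \<open>G\<^sub>I\<close> of a face of \<open>U\<close>, then \<open>x - \<phi> x\<close> is orthogonal to
  that face, so on \<open>closure (\<phi>\<^sup>-\<^sup>1 G\<^sub>I)\<close> the map \<open>\<phi>\<close> is the orthogonal projection onto the affine span
  of the face, which is the translate of \<open>Q\<^sub>I\<close> by \<open>(c - c\<^sub>I)/2\<close>.  Splitting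
  \<open>x - c\<close> into components parallel and orthogonal to \<open>Q\<^sub>I\<close> gives the formula for the energy.
  Moreover \<open>\<nabla>\<E> x = x - 2 \<phi> x + c\<close>, which on this closure is an affine map whose linear part is
  the reflection \<open>1 - 2P\<close>, where \<open>P\<close> is the orthogonal projection onto the direction of \<open>Q\<^sub>I\<close>.
\<close>

section \<open>Distances to sets and the derivative of the squared distance\<close>

text \<open>By Pythagoras no \<open>s\<close> in \<open>S\<close> is closer to \<open>x\<close> than
  \<open>q\<close>, so the infimum is attained at \<open>q\<close>.\<close>

lemma infdist_orthogonal:
  fixes x q :: "'a::real_inner"
  assumes "q \<in> S" and orth: "\<And>s. s \<in> S \<Longrightarrow> (x - q) \<bullet> (s - q) = 0"
  shows "infdist x S = norm (x - q)"
proof (rule antisym)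
  show "infdist x S \<le> norm (x - q)"
    using infdist_le[OF \<open>q \<in> S\<close>, of x] by (simp add: dist_norm)
  have "norm (x - q) \<le> dist x s" if "s \<in> S" for s
  proof -
    have "(norm (x - s))\<^sup>2 = (norm (x - q))\<^sup>2 + (norm (s - q))\<^sup>2"
      using orth[OF that] by (simp add: power2_norm_eq_inner inner_diff inner_commute algebra_simps)
    then have "(norm (x - q))\<^sup>2 \<le> (norm (x - s))\<^sup>2" by simp
    then show ?thesis by (simp add: dist_norm power_mono_iff)
  qed
  then show "norm (x - q) \<le> infdist x S"
    using \<open>q \<in> S\<close> unfolding infdist_def by (auto intro!: cINF_greatest)
qed

lemma has_derivative_quadratic_bound:
  fixes f :: "'a::real_normed_vector \<Rightarrow> real"
  assumes "bounded_linear D" and "\<And>y. \<bar>f y - f x - D (y - x)\<bar> \<le> C * (norm (y - x))\<^sup>2"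
  shows "(f has_derivative D) (at x)"
  unfolding has_derivative_at
proof (rule conjI[OF assms(1)], rule Lim_null_comparison)
  show "\<forall>\<^sub>F h in at 0. norm (norm (f (x + h) - f x - D h) / norm h) \<le> C * norm h"
  proof (rule always_eventually, rule allI)
    fix h
    show "norm (norm (f (x + h) - f x - D h) / norm h) \<le> C * norm h"
      using assms(2)[of "x + h"] by (cases "h = 0") (auto simp: field_simps power2_eq_square)
  qed
  show "((\<lambda>h. C * norm h) \<longlongrightarrow> 0) (at 0)"
    by (auto intro!: tendsto_eq_intros)
qed

text \<open>Each of the two nearest points is a competitor for the other base point. This bounds the
  error of the linear approximation from both sides by a multiple of
  \<open>(norm (y - x))\<^sup>2\<close>.\<close>

lemma GDERIV_dist_closest_point_squared:
  fixes S :: "'a::euclidean_space set"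
  assumes "convex S" "closed S" "S \<noteq> {}"
  shows "GDERIV (\<lambda>y. (norm (y - closest_point S y))\<^sup>2) x :> 2 *\<^sub>R (x - closest_point S x)"
  unfolding gderiv_def
proof (rule has_derivative_quadratic_bound[where C = 1])
  show "bounded_linear (\<lambda>h. h \<bullet> (2 *\<^sub>R (x - closest_point S x)))"
    by (rule bounded_linear_inner_left)
  fix y
  let ?p = "closest_point S x" and ?q = "closest_point S y"
  have S: "?p \<in> S" "?q \<in> S"
    using assms by (auto intro: closest_point_in_set)
  have "(norm (y - ?q))\<^sup>2 \<le> (norm (y - ?p))\<^sup>2" "(norm (x - ?p))\<^sup>2 \<le> (norm (x - ?q))\<^sup>2"
    using closest_point_le[OF assms(2) S(1), of y] closest_point_le[OF assms(2) S(2), of x]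
    by (auto simp: dist_norm intro!: power_mono)
  \<comment> \<open>Needed for the lower bound: the error is at least
    \<open>(norm (y - x))\<^sup>2\<close> minus twice this inner product, and the nearest-point map
    is 1-Lipschitz. Hence the constant 1.\<close>
  moreover have "(?q - ?p) \<bullet> (y - x) \<le> (norm (y - x))\<^sup>2"
  proof -
    have "(?q - ?p) \<bullet> (y - x) \<le> norm (?q - ?p) * norm (y - x)"
      by (rule norm_cauchy_schwarz)
    also have "\<dots> \<le> norm (y - x) * norm (y - x)"
      using closest_point_lipschitz[OF assms, of y x]
      by (intro mult_right_mono) (auto simp: dist_norm)
    finally show ?thesis by (simp add: power2_eq_square)
  qed
  ultimately show "\<bar>(norm (y - ?q))\<^sup>2 - (norm (x - ?p))\<^sup>2 - (y - x) \<bullet> (2 *\<^sub>R (x - ?p))\<bar>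
      \<le> 1 * (norm (y - x))\<^sup>2"
    by (simp add: power2_norm_eq_inner inner_diff inner_commute algebra_simps abs_le_iff)
qed

section \<open>Orthogonality of \<open>Q_face\<close> and \<open>H_face\<close>, and circumcenters
  of faces\<close>

text \<open>A level set of the functional \<open>a \<bullet> _\<close> is affine and contains all
  \<open>v i\<close>, hence also their affine hull.\<close>

lemma affine_hull_image_inner_eq:
  assumes "\<And>i j. i \<in> I \<Longrightarrow> j \<in> I \<Longrightarrow> a \<bullet> (v i - v j) = 0"
    and "q \<in> affine hull (v ` I)" "q' \<in> affine hull (v ` I)"
  shows "a \<bullet> (q - q') = 0"
proof -
  have "I \<noteq> {}"
    using assms(2) by (metis affine_hull_empty empty_iff image_empty)
  then obtain i where "i \<in> I" by blast
  have "a \<bullet> v j = a \<bullet> v i" if "j \<in> I" for j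
    using assms(1)[OF that \<open>i \<in> I\<close>] by (simp add: inner_diff_right)
  then have "affine hull (v ` I) \<subseteq> {z. a \<bullet> z = a \<bullet> v i}"
    by (intro hull_minimal affine_hyperplane) blast
  with assms(2,3) have "a \<bullet> q = a \<bullet> v i" "a \<bullet> q' = a \<bullet> v i"
    by auto
  then show ?thesis
    by (simp add: inner_diff_right)
qed

text \<open>The difference of the squared distances to \<open>a\<close> and \<open>b\<close> is
  affine in the base point, with linear part \<open>-2 * (_ \<bullet> (a - b))\<close>.\<close>

lemma dist_eq_iff_inner:
  fixes x y a b :: "'a::real_inner"
  assumes "dist x a = dist x b"
  shows "dist y a = dist y b \<longleftrightarrow> (y - x) \<bullet> (a - b) = 0"
proof -
  have "(dist x a)\<^sup>2 = (dist x b)\<^sup>2" using assms by simp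
  moreover have "dist y a = dist y b \<longleftrightarrow> (dist y a)\<^sup>2 = (dist y b)\<^sup>2"
    by (simp add: power2_eq_iff_nonneg)
  ultimately show ?thesis
    by (auto simp: dist_norm power2_norm_eq_inner inner_diff inner_commute algebra_simps)
qed

lemma H_faceD: "h \<in> H_face v I \<Longrightarrow> i \<in> I \<Longrightarrow> j \<in> I \<Longrightarrow> dist h (v i) = dist h (v j)"
  unfolding H_face_def by blast

lemma H_face_orthogonal:
  assumes "h \<in> H_face v I" "h' \<in> H_face v I" "q \<in> Q_face v I" "q' \<in> Q_face v I"
  shows "(h - h') \<bullet> (q - q') = 0"
proof (rule affine_hull_image_inner_eq)
  fix i j assume ij: "i \<in> I" "j \<in> I"
  show "(h - h') \<bullet> (v i - v j) = 0"
    using dist_eq_iff_inner[OF H_faceD[OF assms(2) ij]] H_faceD[OF assms(1) ij] by blast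
qed (use assms in \<open>auto simp: Q_face_def\<close>)

text \<open>A displacement orthogonal to all edges of the face preserves equidistance; this later
  produces the foot of the perpendicular on \<open>H_face v I\<close>.\<close>

lemma H_face_orthogonalI:
  assumes "h \<in> H_face v I" "\<And>i j. i \<in> I \<Longrightarrow> j \<in> I \<Longrightarrow> (h' - h) \<bullet> (v i - v j) = 0"
  shows "h' \<in> H_face v I"
  unfolding H_face_def
proof (intro CollectI ballI)
  fix i j assume ij: "i \<in> I" "j \<in> I"
  show "dist h' (v i) = dist h' (v j)"
    using dist_eq_iff_inner[OF H_faceD[OF assms(1) ij]] assms(2)[OF ij] by blast
qed

text \<open>
  Equidistance from \<open>v k\<close> and \<open>v i\<close> prescribes the inner product of \<open>c - v k\<close> with the basis vector
  \<open>v i - v k\<close>; these values define a linear functional, which is represented by a vector \<open>z\<close> and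
  then projected onto the direction of \<open>Q\<^sub>I\<close>.
\<close>

lemma ex1_face_circumcenter:
  fixes v :: "nat \<Rightarrow> 'a::euclidean_space"
  assumes ind: "\<not> affine_dependent (v ` I)" and "I \<noteq> {}"
  shows "\<exists>!c. c \<in> Q_face v I \<and> c \<in> H_face v I"
proof (rule ex_ex1I)
  obtain k where k: "k \<in> I" using \<open>I \<noteq> {}\<close> by auto
  define B where "B = (\<lambda>x. - v k + x) ` (v ` I - {v k})"
  have "independent B"
    using affine_dependent_iff_dependent2[of "v k" "v ` I"] ind k by (auto simp: B_def)
  \<comment> \<open>The values come from expanding squares: \<open>norm (y - x) = norm y\<close>
    holds exactly when \<open>y \<bullet> x = (x \<bullet> x) / 2\<close>.\<close>
  then obtain f :: "'a \<Rightarrow> real" where "linear f" and f: "\<And>x. x \<in> B \<Longrightarrow> f x = (x \<bullet> x) / 2"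
    using linear_independent_extend[of B "\<lambda>x. (x \<bullet> x) / 2"] by blast
  define z where "z = (\<Sum>b\<in>Basis. f b *\<^sub>R b)"
  have z: "z \<bullet> x = f x" for x
  proof -
    have "f x = f (\<Sum>b\<in>Basis. (x \<bullet> b) *\<^sub>R b)"
      by (simp add: euclidean_representation)
    also have "\<dots> = (\<Sum>b\<in>Basis. (x \<bullet> b) * f b)"
      using \<open>linear f\<close> by (simp add: linear_sum linear_scale)
    finally show ?thesis
      by (simp add: z_def inner_sum_right inner_commute[of _ x] mult.commute)
  qed
  obtain y w where y: "y \<in> span B" and w: "\<And>x. x \<in> span B \<Longrightarrow> orthogonal w x" and zyw: "z = y + w"
    using orthogonal_subspace_decomp_exists[of B z] by metis
  have in_Q: "v k + y \<in> Q_face v I"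
    using y k affine_hull_span2[of "v k" "v ` I"] by (auto simp: Q_face_def B_def)
  have yB: "y \<bullet> x = (x \<bullet> x) / 2" if "x \<in> B" for x
    using f[OF that] z[of x] w[OF span_base[OF that]] zyw
    by (simp add: orthogonal_def inner_add_left)
  have "dist (v k + y) (v i) = norm y" if "i \<in> I" for i
  proof (cases "v i = v k")
    case False
    with that have "v i - v k \<in> B"
      by (auto simp: B_def image_iff intro!: bexI[of _ "v i"])
    from yB[OF this] have "(norm (y - (v i - v k)))\<^sup>2 = (norm y)\<^sup>2"
      by (simp only: power2_norm_eq_inner) (simp add: inner_diff inner_commute algebra_simps)
    then have "norm (y - (v i - v k)) = norm y"
      by (simp add: power2_eq_iff_nonneg)
    then show ?thesis
      by (simp add: dist_norm algebra_simps)
  qed (simp add: dist_norm)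
  then have "v k + y \<in> H_face v I"
    by (simp add: H_face_def)
  with in_Q show "\<exists>c. c \<in> Q_face v I \<and> c \<in> H_face v I"
    by blast
  \<comment> \<open>Uniqueness: \<open>c - c'\<close> is a direction of both
    \<open>H_face v I\<close> and \<open>Q_face v I\<close>, hence orthogonal to itself.\<close>
  fix c c' assume "c \<in> Q_face v I \<and> c \<in> H_face v I" "c' \<in> Q_face v I \<and> c' \<in> H_face v I"
  then have "(c - c') \<bullet> (c - c') = 0"
    using H_face_orthogonal by blast
  then show "c = c'" by simp
qed

section \<open>Nondegeneracy and barycentric coordinates\<close>

text \<open>If the vertices had affine dimension below \<open>DIM('a)\<close>, a hyperplane would
  contain them and thus the simplex. Full dimension requires at least \<open>DIM('a) + 1\<close>
  distinct vertices, which is also the number of indices.\<close>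

lemma nondegenerate_imp:
  fixes v :: "nat \<Rightarrow> 'a::euclidean_space"
  assumes "nondegenerate v"
  shows "inj_on v {0..DIM('a)}" and "\<not> affine_dependent (v ` {0..DIM('a)})"
    and "Q_face v {0..DIM('a)} = UNIV"
proof -
  let ?S = "v ` {0..DIM('a)}"
  have dim: "aff_dim ?S = int DIM('a)"
  proof (rule ccontr)
    assume "aff_dim ?S \<noteq> int DIM('a)"
    then have "aff_dim ?S < int DIM('a)"
      using aff_dim_le_DIM[of ?S] by linarith
    then obtain a b where "a \<noteq> 0" and sub: "?S \<subseteq> {x. a \<bullet> x = b}"
      using aff_lowdim_subset_hyperplane by blast
    have "simplex_of v \<subseteq> {x. a \<bullet> x = b}"
      unfolding simplex_of_def using sub by (intro hull_minimal convex_hyperplane)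
    moreover have "aff_dim {x. a \<bullet> x = b} = int DIM('a) - 1"
      using aff_dim_hyperplane[OF \<open>a \<noteq> 0\<close>, of b] by simp
    ultimately show False
      using assms affine_hyperplane[of a b] unfolding nondegenerate_def by blast
  qed
  have "int (card ?S) \<ge> int DIM('a) + 1"
    using aff_dim_le_card[of ?S] dim by simp
  moreover have "card ?S \<le> DIM('a) + 1"
    using card_image_le[of "{0..DIM('a)}" v] by simp
  ultimately have card: "card ?S = DIM('a) + 1" by simp
  then show "inj_on v {0..DIM('a)}"
    by (intro eq_card_imp_inj_on) auto
  show "\<not> affine_dependent ?S"
    using card dim by (simp add: affine_independent_iff_card)
  show "Q_face v {0..DIM('a)} = UNIV"
    unfolding Q_face_def using dim aff_dim_eq_full by blast
qed

text \<open>The difference of two coordinate families, carried from indices to points by the inverse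
  of \<open>v\<close>, would be an affine dependence.\<close>

lemma barycentric_unique:
  fixes v :: "nat \<Rightarrow> 'a::euclidean_space"
  assumes "inj_on v J" "finite J" "\<not> affine_dependent (v ` J)"
    and "sum b J = 1" "sum b' J = (1::real)"
    and eq: "(\<Sum>i\<in>J. b i *\<^sub>R v i) = (\<Sum>i\<in>J. b' i *\<^sub>R v i)" and "i \<in> J"
  shows "b i = b' i"
proof (rule ccontr)
  assume ne: "b i \<noteq> b' i"
  let ?u = "\<lambda>x. b (the_inv_into J v x) - b' (the_inv_into J v x)"
  have inv: "\<And>i. i \<in> J \<Longrightarrow> the_inv_into J v (v i) = i"
    using assms(1) by (simp add: the_inv_into_f_f)
  have "sum ?u (v ` J) = 0" "(\<Sum>x\<in>v ` J. ?u x *\<^sub>R x) = 0"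
    using assms(1,4,5) eq
    by (simp_all add: sum.reindex inv sum_subtractf scaleR_left_diff_distrib cong: sum.cong)
  moreover have "\<exists>x\<in>v ` J. ?u x \<noteq> 0"
    using \<open>i \<in> J\<close> ne inv by (intro bexI[of _ "v i"]) auto
  ultimately have "affine_dependent (v ` J)"
    unfolding affine_dependent_explicit_finite[OF finite_imageI[OF assms(2)]] by blast
  with assms(3) show False by blast
qed

lemma affine_hull_inj_image:
  assumes "inj_on v J" "finite J"
  shows "affine hull (v ` J) = {(\<Sum>i\<in>J. b i *\<^sub>R v i) |b. sum b J = 1}" (is "?L = ?R")
proof
  show "?L \<subseteq> ?R"
  proof
    fix x assume "x \<in> ?L"
    then obtain u where "sum u (v ` J) = 1" "(\<Sum>y\<in>v ` J. u y *\<^sub>R y) = x"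
      using assms(2) by (auto simp: affine_hull_finite)
    then show "x \<in> ?R"
      using assms(1) by (auto simp: sum.reindex intro!: exI[of _ "u \<circ> v"])
  qed
  show "?R \<subseteq> ?L"
  proof
    fix x assume "x \<in> ?R"
    then obtain b where "sum b J = 1" "x = (\<Sum>i\<in>J. b i *\<^sub>R v i)" by auto
    then have "sum (b \<circ> the_inv_into J v) (v ` J) = 1"
        "(\<Sum>y\<in>v ` J. (b \<circ> the_inv_into J v) y *\<^sub>R y) = x"
      using assms(1) by (simp_all add: sum.reindex the_inv_into_f_f cong: sum.cong)
    then show "x \<in> ?L"
      using assms(2) by (auto simp: affine_hull_finite)
  qed
qed

text \<open>Affine combinations commute with the homothety of ratio 1/2 about the circumcenter, so
  the coordinates of \<open>p\<close> relative to \<open>U\<close> are those of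
  \<open>2 *\<^sub>R p - circumcenter v\<close> relative to \<open>T\<close>.\<close>

lemma sum_u_vertex:
  assumes "sum b J = 1"
  shows "(\<Sum>i\<in>J. b i *\<^sub>R u_vertex v i) = (1/2) *\<^sub>R (circumcenter v + (\<Sum>i\<in>J. b i *\<^sub>R v i))"
proof -
  have "(\<Sum>i\<in>J. b i *\<^sub>R u_vertex v i)
      = (1/2) *\<^sub>R (sum b J *\<^sub>R circumcenter v + (\<Sum>i\<in>J. b i *\<^sub>R v i))"
    unfolding u_vertex_def scaleR_sum_left sum.distrib[symmetric] scaleR_sum_right
    by (intro sum.cong) (auto simp: algebra_simps)
  with assms show ?thesis by simp
qed

text \<open>Justifies the definite description in \<open>barycentric\<close>: the homothety
  transfers existence and uniqueness from the vertices \<open>v i\<close>, which are affinely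
  independent and span the whole space.\<close>

lemma barycentric_u_vertex:
  fixes v :: "nat \<Rightarrow> 'a::euclidean_space" and p :: 'a
  assumes nd: "nondegenerate v"
  defines "b \<equiv> barycentric (u_vertex v) p"
  shows "sum b {0..DIM('a)} = 1" and "(\<Sum>i\<in>{0..DIM('a)}. b i *\<^sub>R u_vertex v i) = p"
proof -
  let ?J = "{0..DIM('a)}" and ?u = "u_vertex v"
  let ?P = "\<lambda>b. (\<forall>i. i \<notin> ?J \<longrightarrow> b i = 0) \<and> sum b ?J = 1 \<and> (\<Sum>i\<in>?J. b i *\<^sub>R ?u i) = p"
  note nd' = nondegenerate_imp[OF nd]
  have "2 *\<^sub>R p - circumcenter v \<in> affine hull (v ` ?J)"
    using nd'(3) by (simp add: Q_face_def)
  then obtain a where a: "sum a ?J = 1" "(\<Sum>i\<in>?J. a i *\<^sub>R v i) = 2 *\<^sub>R p - circumcenter v"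
    using affine_hull_inj_image[OF nd'(1)] by auto
  then have "(\<Sum>i\<in>?J. a i *\<^sub>R ?u i) = p"
    by (simp add: sum_u_vertex)
  with a have ex: "?P (\<lambda>i. if i \<in> ?J then a i else 0)"
    by (simp cong: sum.cong_simp)
  have unique: "a = a'" if a: "?P a" and a': "?P a'" for a a'
  proof
    fix i
    have "(1/2) *\<^sub>R (circumcenter v + (\<Sum>i\<in>?J. a i *\<^sub>R v i))
        = (1/2) *\<^sub>R (circumcenter v + (\<Sum>i\<in>?J. a' i *\<^sub>R v i))"
      using a a' by (metis sum_u_vertex)
    then have "(\<Sum>i\<in>?J. a i *\<^sub>R v i) = (\<Sum>i\<in>?J. a' i *\<^sub>R v i)"
      by simp
    then show "a i = a' i"
      using barycentric_unique[of v ?J a a' i] nd' a a' by (cases "i \<in> ?J") auto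
  qed
  have "?P b"
    unfolding b_def barycentric_def by (rule theI[where P = ?P, OF ex]) (rule unique[OF _ ex])
  then show "sum b ?J = 1" and "(\<Sum>i\<in>?J. b i *\<^sub>R ?u i) = p" by auto
qed

section \<open>The nearest-point map and the faces of \<open>U\<close>\<close>

lemma U_simplex_props:
  fixes v :: "nat \<Rightarrow> 'a::euclidean_space"
  shows "convex (U_simplex v)" "closed (U_simplex v)" "U_simplex v \<noteq> {}"
  unfolding U_simplex_def simplex_of_def
  by (rule convex_convex_hull, rule compact_imp_closed, rule finite_imp_compact_convex_hull) auto

text \<open>Only coordinates with index in \<open>I\<close> survive, and inverting the homothety
  turns the combination of the \<open>u_vertex v i\<close> into one of the
  \<open>v i\<close>.\<close>

lemma G_face_affine:
  fixes v :: "nat \<Rightarrow> 'a::euclidean_space"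
  assumes nd: "nondegenerate v" and I: "I \<subseteq> {0..DIM('a)}" and p: "p \<in> G_face v I"
  shows "2 *\<^sub>R p - circumcenter v \<in> Q_face v I"
proof -
  let ?J = "{0..DIM('a)}"
  define b where "b = barycentric (u_vertex v) p"
  have b0: "\<forall>i\<in>?J - I. b i = 0"
    using p by (auto simp: G_face_def b_def)
  note b = barycentric_u_vertex[OF nd, of p, folded b_def]
  have fin: "finite I" using I finite_subset by blast
  have "sum b I = 1" "(\<Sum>i\<in>I. b i *\<^sub>R u_vertex v i) = p"
    using sum.mono_neutral_left[OF _ I, of b] b b0
      sum.mono_neutral_left[OF _ I, of "\<lambda>i. b i *\<^sub>R u_vertex v i"] by auto
  then have "2 *\<^sub>R p - circumcenter v = (\<Sum>i\<in>I. b i *\<^sub>R v i)"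
    by (auto simp: sum_u_vertex)
  also have "\<dots> \<in> affine hull (v ` I)"
    using affine_hull_inj_image[OF inj_on_subset[OF nondegenerate_imp(1)[OF nd] I] fin]
      \<open>sum b I = 1\<close> by blast
  finally show ?thesis by (simp add: Q_face_def)
qed

text \<open>
  Complementary slackness: \<open>(x - \<phi> x) \<bullet> (u\<^sub>k - \<phi> x) \<le> 0\<close> for all \<open>k\<close>, while the average of these numbers
  with the barycentric coordinates of \<open>\<phi> x\<close> as weights is zero.
\<close>

lemma proj_U_G_face_orthogonal:
  fixes v :: "nat \<Rightarrow> 'a::euclidean_space"
  assumes nd: "nondegenerate v" and I: "I \<subseteq> {0..DIM('a)}" and G: "proj_U v x \<in> G_face v I"
    and ij: "i \<in> I" "j \<in> I"
  shows "(x - proj_U v x) \<bullet> (v i - v j) = 0"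
proof -
  let ?J = "{0..DIM('a)}"
  define p where "p = proj_U v x"
  define b where "b = barycentric (u_vertex v) p"
  have pos: "\<forall>i\<in>I. b i > 0" and b0: "\<forall>i\<in>?J - I. b i = 0"
    using G by (auto simp: G_face_def b_def p_def)
  note b = barycentric_u_vertex[OF nd, of p, folded b_def]
  have le: "(x - p) \<bullet> (u_vertex v k - p) \<le> 0" if "k \<in> ?J" for k
    unfolding p_def proj_U_def
    using that by (intro closest_point_dot U_simplex_props)
      (auto simp: U_simplex_def simplex_of_def intro!: hull_inc)
  have "(\<Sum>k\<in>?J. b k * ((x - p) \<bullet> (u_vertex v k - p)))
      = (x - p) \<bullet> ((\<Sum>k\<in>?J. b k *\<^sub>R u_vertex v k) - sum b ?J *\<^sub>R p)"
    by (simp add: scaleR_sum_left sum_subtractf[symmetric] inner_sum_right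
        scaleR_right_diff_distrib[symmetric])
  also have "\<dots> = 0" using b by simp
  finally have "(\<Sum>k\<in>?J. - (b k * ((x - p) \<bullet> (u_vertex v k - p)))) = 0"
    by (simp add: sum_negf)
  moreover have "\<forall>k\<in>?J. 0 \<le> - (b k * ((x - p) \<bullet> (u_vertex v k - p)))"
    using le pos b0 by (metis DiffI less_eq_real_def mult_nonneg_nonpos neg_0_le_iff_le)
  ultimately have "\<forall>k\<in>?J. - (b k * ((x - p) \<bullet> (u_vertex v k - p))) = 0"
    by (subst (asm) sum_nonneg_eq_0_iff) auto
  then have "(x - p) \<bullet> (u_vertex v k - p) = 0" if "k \<in> I" for k
    using that I pos by force
  from this[OF ij(1)] this[OF ij(2)] have "(x - p) \<bullet> (u_vertex v i - u_vertex v j) = 0"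
    by (simp add: inner_diff_right)
  moreover have "u_vertex v i - u_vertex v j = (1/2) *\<^sub>R (v i - v j)"
    by (simp add: u_vertex_def algebra_simps)
  ultimately show ?thesis by (simp add: p_def)
qed

text \<open>Both properties hold on the preimage and are closed conditions because the nearest-point
  map is continuous.\<close>

lemma closure_proj_U_G_face:
  fixes v :: "nat \<Rightarrow> 'a::euclidean_space"
  assumes nd: "nondegenerate v" and I: "I \<subseteq> {0..DIM('a)}"
    and x: "x \<in> closure (proj_U v -` G_face v I)"
  shows "2 *\<^sub>R proj_U v x - circumcenter v \<in> Q_face v I"
    and "\<And>i j. i \<in> I \<Longrightarrow> j \<in> I \<Longrightarrow> (x - proj_U v x) \<bullet> (v i - v j) = 0"
proof -
  let ?A = "(\<lambda>x. 2 *\<^sub>R proj_U v x - circumcenter v) -` Q_face v I"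
  let ?B = "\<Inter>i\<in>I. \<Inter>j\<in>I. {x. (x - proj_U v x) \<bullet> (v i - v j) = 0}"
  have cont: "continuous_on UNIV (proj_U v)"
    unfolding proj_U_def[abs_def] by (intro continuous_on_closest_point U_simplex_props)
  have "closed ?A"
    unfolding Q_face_def by (intro closed_vimage closed_affine_hull continuous_intros cont)
  moreover have "closed ?B"
    by (intro closed_INT ballI closed_Collect_eq continuous_intros cont)
  moreover have "proj_U v -` G_face v I \<subseteq> ?A \<inter> ?B"
    using G_face_affine[OF nd I] proj_U_G_face_orthogonal[OF nd I] by auto
  ultimately have "x \<in> ?A \<inter> ?B"
    using x closure_minimal[of _ "?A \<inter> ?B"] by blast
  then show "2 *\<^sub>R proj_U v x - circumcenter v \<in> Q_face v I"
    and "\<And>i j. i \<in> I \<Longrightarrow> j \<in> I \<Longrightarrow> (x - proj_U v x) \<bullet> (v i - v j) = 0"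
    by auto
qed

section \<open>Circumradii and the gradient of the energy\<close>

lemma the_common_dist:
  assumes "i \<in> I" "c \<in> H_face v I"
  shows "(THE r. \<forall>i\<in>I. dist c (v i) = r) = dist c (v i)"
proof (rule the_equality)
  show "\<forall>j\<in>I. dist c (v j) = dist c (v i)"
    using H_faceD[OF assms(2) _ assms(1)] by blast
  show "r = dist c (v i)" if "\<forall>j\<in>I. dist c (v j) = r" for r
    using bspec[OF that assms(1)] by (rule sym)
qed

lemma gradient_energy:
  fixes v :: "nat \<Rightarrow> 'a::euclidean_space"
  shows "gradient (energy v) x = x - 2 *\<^sub>R proj_U v x + circumcenter v"
proof -
  have "((\<lambda>y. (norm (y - proj_U v y))\<^sup>2) has_derivative (\<lambda>h. h \<bullet> (2 *\<^sub>R (x - proj_U v x)))) (at x)"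
    using GDERIV_dist_closest_point_squared[OF U_simplex_props, of v x]
    by (simp only: gderiv_def proj_U_def)
  moreover have "((\<lambda>y. (circumradius v)\<^sup>2 / 4 - (1/2) * (norm (y - circumcenter v))\<^sup>2)
      has_derivative (\<lambda>h. - (h \<bullet> (x - circumcenter v)))) (at x)"
    unfolding power2_norm_eq_inner
    by (auto intro!: derivative_eq_intros simp: inner_commute)
  ultimately have "((\<lambda>y. (norm (y - proj_U v y))\<^sup>2
        + ((circumradius v)\<^sup>2 / 4 - (1/2) * (norm (y - circumcenter v))\<^sup>2))
      has_derivative (\<lambda>h. h \<bullet> (2 *\<^sub>R (x - proj_U v x)) + - (h \<bullet> (x - circumcenter v)))) (at x)"
    by (rule has_derivative_add)
  also have "(\<lambda>y. (norm (y - proj_U v y))\<^sup>2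
      + ((circumradius v)\<^sup>2 / 4 - (1/2) * (norm (y - circumcenter v))\<^sup>2)) = energy v"
    by (auto simp: energy_def)
  also have "(\<lambda>h. h \<bullet> (2 *\<^sub>R (x - proj_U v x)) + - (h \<bullet> (x - circumcenter v)))
      = (\<lambda>h. h \<bullet> (x - 2 *\<^sub>R proj_U v x + circumcenter v))"
    by (auto simp: inner_diff_right inner_add_right)
  finally have deriv: "GDERIV (energy v) x :> x - 2 *\<^sub>R proj_U v x + circumcenter v"
    by (simp add: gderiv_def)
  \<comment> \<open>A derivative determines its representing vector, so the definite description in
    \<open>gradient\<close> denotes this vector.\<close>
  moreover have "g = g'" if "GDERIV (energy v) x :> g" "GDERIV (energy v) x :> g'" for g g'
  proof -
    have "(\<lambda>h. h \<bullet> g) = (\<lambda>h. h \<bullet> g')"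
      using that unfolding gderiv_def by (rule has_derivative_unique)
    then show ?thesis
      by (metis inner_commute vector_eq_rdot)
  qed
  ultimately show ?thesis
    unfolding gradient_def by (intro the_equality) auto
qed

section \<open>The energy formula and the isometry on the closed preimage of a face\<close>

theorem theorem5p3:
  fixes v :: "nat \<Rightarrow> 'a::euclidean_space" and I :: "nat set"
  assumes "nondegenerate v"
    and "I \<subseteq> {0..DIM('a)}" and "I \<noteq> {}"
  shows "(\<forall>x \<in> closure (proj_U v -` G_face v I).
            energy v x = (face_circumradius v I)\<^sup>2 / 4
              - (1/2) * (infdist x (H_face v I))\<^sup>2 + (1/2) * (infdist x (Q_face v I))\<^sup>2)
       \<and> (\<forall>x \<in> closure (proj_U v -` G_face v I). \<forall>y \<in> closure (proj_U v -` G_face v I).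
            norm (gradient (energy v) x - gradient (energy v) y) = norm (x - y))"
proof (intro conjI ballI)
  let ?J = "{0..DIM('a)}"
  note nd = nondegenerate_imp[OF assms(1)]
  note cl = closure_proj_U_G_face[OF assms(1,2)]
  have cl_orth: "(x - proj_U v x) \<bullet> (q - q') = 0"
    if "x \<in> closure (proj_U v -` G_face v I)" "q \<in> Q_face v I" "q' \<in> Q_face v I" for x q q'
    using affine_hull_image_inner_eq[OF cl(2)[OF that(1)] that(2,3)[unfolded Q_face_def]] .
  define c where "c = circumcenter v"
  define e where "e = face_circumcenter v I"
  obtain k where k: "k \<in> I" using assms(3) by auto
  \<comment> \<open>For the full index set \<open>Q_face\<close> is the whole space, so the face
    circumcenter result applies to \<open>circumcenter\<close>.\<close>
  have "c \<in> H_face v ?J"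
    using theI'[OF ex1_face_circumcenter[OF nd(2)]] nd(3)
    by (simp add: c_def circumcenter_def)
  moreover from this have cH: "c \<in> H_face v I"
    using assms(2) unfolding H_face_def by blast
  moreover have "\<not> affine_dependent (v ` I)"
    using nd(2) affine_dependent_subset[OF _ image_mono[OF assms(2)], of v] by blast
  then have e: "e \<in> Q_face v I" "e \<in> H_face v I"
    using theI'[OF ex1_face_circumcenter[OF _ assms(3)]]
    unfolding e_def face_circumcenter_def by blast+
  ultimately have R: "circumradius v = dist c (v k)" "face_circumradius v I = dist e (v k)"
    unfolding circumradius_def face_circumradius_def c_def[symmetric] e_def[symmetric]
    using the_common_dist[of k] k assms(2) by blast+
  have vQ: "v i \<in> Q_face v I" if "i \<in> I" for i
    using that by (auto simp: Q_face_def intro: hull_inc)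
  \<comment> \<open>\<open>e\<close> is the foot of the perpendicular from \<open>c\<close> to
    \<open>Q_face v I\<close>.\<close>
  have pyth: "(dist c (v k))\<^sup>2 = (norm (c - e))\<^sup>2 + (dist e (v k))\<^sup>2"
    using H_face_orthogonal[OF cH e(2) e(1) vQ[OF k]]
    by (simp add: dist_norm power2_norm_eq_inner inner_diff inner_commute algebra_simps)
  show "energy v x = (face_circumradius v I)\<^sup>2 / 4
      - (1/2) * (infdist x (H_face v I))\<^sup>2 + (1/2) * (infdist x (Q_face v I))\<^sup>2"
    if x: "x \<in> closure (proj_U v -` G_face v I)" for x
  proof -
    define p where "p = proj_U v x"
    \<comment> \<open>the component of \<open>x - c\<close> parallel to \<open>Q\<^sub>I\<close>\<close>
    define t where "t = p - (1/2) *\<^sub>R (c + e)"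
    have pQ: "2 *\<^sub>R p - c \<in> Q_face v I"
      using cl(1)[OF x] by (simp add: p_def c_def)
    have orth: "(x - p) \<bullet> (q - q') = 0" if "q \<in> Q_face v I" "q' \<in> Q_face v I" for q q'
      using cl_orth[OF x that] by (simp only: p_def)
    have ce: "(c - e) \<bullet> (q - q') = 0" if "q \<in> Q_face v I" "q' \<in> Q_face v I" for q q'
      using H_face_orthogonal[OF cH e(2)] that by blast
    have t: "2 *\<^sub>R t = (2 *\<^sub>R p - c) - e"
      by (simp add: t_def algebra_simps)
    have tQ: "e + t \<in> Q_face v I"
    proof -
      \<comment> \<open>\<open>e + t\<close> is the midpoint of two points of
        \<open>Q_face v I\<close>.\<close>
      have "(1/2) *\<^sub>R e + (1/2) *\<^sub>R (2 *\<^sub>R p - c) \<in> Q_face v I"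
        using e(1) pQ unfolding Q_face_def by (intro mem_affine affine_affine_hull) auto
      moreover have "e + t = (1/2) *\<^sub>R e + (1/2) *\<^sub>R (2 *\<^sub>R p - c)"
        using scaleR_half_double[of e]
        unfolding t_def scaleR_right_diff_distrib scaleR_right_distrib
        by (simp add: diff_eq_eq)
      ultimately show ?thesis by simp
    qed
    have xt: "x - (c + t) = (x - p) - (1/2) *\<^sub>R (c - e)" "x - (e + t) = (x - p) + (1/2) *\<^sub>R (c - e)"
      by (simp_all add: t_def algebra_simps flip: scaleR_add_left)
    have tH: "x - t \<in> H_face v I"
    proof (rule H_face_orthogonalI[OF cH])
      fix i j assume ij: "i \<in> I" "j \<in> I"
      have *: "x - t - c = (x - p) - (1/2) *\<^sub>R (c - e)"
        using xt(1) by (simp add: algebra_simps)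
      show "(x - t - c) \<bullet> (v i - v j) = 0"
        unfolding * inner_diff_left[of "x - p"] inner_scaleR_left
        by (simp add: orth[OF ij[THEN vQ]] ce[OF ij[THEN vQ]])
    qed
    \<comment> \<open>The foot is \<open>x - t\<close>, since \<open>2 *\<^sub>R t\<close> is a
      difference of two points of \<open>Q_face v I\<close>.\<close>
    have "infdist x (H_face v I) = norm (x - (x - t))"
    proof (rule infdist_orthogonal[OF tH])
      fix s assume "s \<in> H_face v I"
      from H_face_orthogonal[OF this tH pQ e(1), folded t]
      show "(x - (x - t)) \<bullet> (s - (x - t)) = 0"
        by (simp add: inner_commute)
    qed
    moreover have "infdist x (Q_face v I) = norm (x - (e + t))"
    proof (rule infdist_orthogonal[OF tQ])
      fix s assume "s \<in> Q_face v I"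
      then show "(x - (e + t)) \<bullet> (s - (e + t)) = 0"
        using orth[OF _ tQ] ce[OF _ tQ] by (simp only: xt inner_add_left) simp
    qed
    moreover have "(norm (x - (e + t)))\<^sup>2
        = (norm (x - p))\<^sup>2 + (x - p) \<bullet> (c - e) + (norm (c - e))\<^sup>2 / 4"
      unfolding xt power2_norm_eq_inner
      by (simp add: inner_add_left inner_add_right inner_commute)
    moreover have "(norm (x - c))\<^sup>2
        = (norm (x - p))\<^sup>2 - (x - p) \<bullet> (c - e) + (norm (c - e))\<^sup>2 / 4 + (norm t)\<^sup>2"
    proof -
      have "(x - p) \<bullet> t = 0" "(c - e) \<bullet> t = 0"
        using orth[OF pQ e(1)] ce[OF pQ e(1)] by (simp_all flip: t)
      moreover have xc: "x - c = (x - p) - (1/2) *\<^sub>R (c - e) + t"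
        using xt(1) by (simp add: algebra_simps)
      ultimately show ?thesis
        unfolding xc power2_norm_eq_inner
        by (simp add: inner_add_left inner_add_right inner_diff_left[of "x - p"]
            inner_diff_right[of _ "x - p"] inner_commute)
    qed
    \<comment> \<open>With \<open>n = x - p\<close> and \<open>m = (1/2) *\<^sub>R (c - e)\<close>,
      the distance to \<open>Q_face v I\<close> is \<open>norm (n + m)\<close>, while
      \<open>x - c\<close> is \<open>n - m\<close> plus the orthogonal vector \<open>t\<close>. The
      formula is then the parallelogram law for \<open>n\<close> and \<open>m\<close>, with
      \<open>(norm m)\<^sup>2\<close> being the difference of the squared radii over 4.\<close>
    ultimately show ?thesis
      using pyth by (simp add: energy_def R c_def[symmetric] p_def[symmetric] field_simps)
  qed
  show "norm (gradient (energy v) x - gradient (energy v) y) = norm (x - y)"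
    if x: "x \<in> closure (proj_U v -` G_face v I)"
      and y: "y \<in> closure (proj_U v -` G_face v I)" for x y
  proof -
    define a where "a = x - y"
    define d where "d = proj_U v x - proj_U v y"
    have d: "2 *\<^sub>R d = (2 *\<^sub>R proj_U v x - c) - (2 *\<^sub>R proj_U v y - c)"
      by (simp add: d_def algebra_simps)
    have "(x - proj_U v x) \<bullet> (2 *\<^sub>R d) = 0" "(y - proj_U v y) \<bullet> (2 *\<^sub>R d) = 0"
      unfolding d c_def
      by (rule cl_orth[OF x cl(1)[OF x] cl(1)[OF y]], rule cl_orth[OF y cl(1)[OF x] cl(1)[OF y]])
    \<comment> \<open>Subtracting the two relations makes \<open>a - d\<close> orthogonal to
      \<open>d\<close>, so \<open>a - 2 *\<^sub>R d\<close> arises from \<open>a\<close> by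
      reversing its component \<open>d\<close>.\<close>
    then have "(a - d) \<bullet> d = 0"
      by (simp add: a_def d_def inner_diff)
    then have "(norm (a - 2 *\<^sub>R d))\<^sup>2 = (norm a)\<^sup>2"
      by (simp add: power2_norm_eq_inner inner_diff inner_commute algebra_simps)
    then have "norm (a - 2 *\<^sub>R d) = norm a"
      by (simp add: power2_eq_iff_nonneg)
    moreover have "gradient (energy v) x - gradient (energy v) y = a - 2 *\<^sub>R d"
      by (simp add: gradient_energy a_def d_def algebra_simps)
    ultimately show ?thesis by (simp add: a_def)
  qed
qed

end
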